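(* Let $S=(1,s_2,\ldots)$ be a packing sequence and $k\ge 2$ an integer. (i) If $S\in\mathcal{S}(k)$, i.e. $2^{i-1}\le s_i<2^i$ for all $i\le k-1$ and $s_k<2^{k-1}$, then the path $P_n$ is $\chi_S$-critical if and only if $n\in\{2^0,2^1,\ldots,2^{k-1}\}$. (ii) If $2^{i-1}\le s_i<2^i$ holds for every entry $s_i$ of $S$, then $P_n$ is $\chi_S$-critical if and only if $n\in\{2^j : j\in\mathbb{N}_0\}$.
   Context: A packing sequence is a non-decreasing infinite sequence $S=(s_1,s_2,\ldots)$ of positive integers. For a graph $G$, a map $\phi\colon V(G)\to\{1,\ldots,k\}$ is an $S$-packing $k$-coloring if any two distinct vertices $u,v$ with $\phi(u)=\phi(v)=i$ satisfy $d_G(u,v) > s_i$; $\chi_S(G)$ is the least such $k$. A graph $G$ is $\chi_S$-critical if $\chi_S(H)<\chi_S(G)$ for every proper subgraph $H$ of $G$. $P_n$ denotes the path on $n\ge1$ vertices. For $k\ge2$, $\mathcal{S}(k)$ is the set of packing sequences with $2^{i-1}\le s_i<2^i$ for all $i\le k-1$ and $s_k<2^{k-1}$. *)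

theory Defs
  imports Main "HOL-Library.FuncSet" "HOL-Library.Extended_Nat"
begin

record 'a ugraph =
  verts :: "'a set"
  edges :: "'a set set"

definition simple_graph :: "'a ugraph \<Rightarrow> bool" where
  "simple_graph G \<longleftrightarrow> (\<forall>e\<in>edges G. e \<subseteq> verts G \<and> card e = 2)"

definition subgraph :: "'a ugraph \<Rightarrow> 'a ugraph \<Rightarrow> bool" where
  "subgraph H G \<longleftrightarrow> simple_graph H \<and> verts H \<subseteq> verts G \<and> edges H \<subseteq> edges G"

definition proper_subgraph :: "'a ugraph \<Rightarrow> 'a ugraph \<Rightarrow> bool" where
  "proper_subgraph H G \<longleftrightarrow> subgraph H G \<and> H \<noteq> G"

definition path_between :: "'a ugraph \<Rightarrow> 'a \<Rightarrow> 'a list \<Rightarrow> 'a \<Rightarrow> bool" where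
  "path_between G u p v \<longleftrightarrow>
     p \<noteq> [] \<and> hd p = u \<and> last p = v \<and> distinct p \<and> set p \<subseteq> verts G \<and>
     (\<forall>i. Suc i < length p \<longrightarrow> {p ! i, p ! Suc i} \<in> edges G)"

(* The infimum over the empty set is \<infinity>, so vertices in different
   components are at infinite distance. *)
definition graph_dist :: "'a ugraph \<Rightarrow> 'a \<Rightarrow> 'a \<Rightarrow> enat" where
  "graph_dist G u v = (INF p\<in>{p. path_between G u p v}. enat (length p - 1))"

(* Sequences are indexed from 1, as are the colors; the value S 0 is irrelevant. *)
definition packing_sequence :: "(nat \<Rightarrow> nat) \<Rightarrow> bool" where
  "packing_sequence S \<longleftrightarrow>
     (\<forall>i\<ge>1. S i > 0) \<and> (\<forall>i j. 1 \<le> i \<and> i \<le> j \<longrightarrow> S i \<le> S j)"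

definition packing_coloring :: "(nat \<Rightarrow> nat) \<Rightarrow> 'a ugraph \<Rightarrow> nat \<Rightarrow> ('a \<Rightarrow> nat) \<Rightarrow> bool" where
  "packing_coloring S G k \<phi> \<longleftrightarrow>
     \<phi> \<in> verts G \<rightarrow> {1..k} \<and>
     (\<forall>u\<in>verts G. \<forall>v\<in>verts G. \<forall>i.
        u \<noteq> v \<and> \<phi> u = i \<and> \<phi> v = i \<longrightarrow> graph_dist G u v > enat (S i))"

definition chi :: "(nat \<Rightarrow> nat) \<Rightarrow> 'a ugraph \<Rightarrow> nat" where
  "chi S G = (LEAST k. \<exists>\<phi>. packing_coloring S G k \<phi>)"

definition chi_critical :: "(nat \<Rightarrow> nat) \<Rightarrow> 'a ugraph \<Rightarrow> bool" where
  "chi_critical S G \<longleftrightarrow> (\<forall>H. proper_subgraph H G \<longrightarrow> chi S H < chi S G)"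

definition path_graph :: "nat \<Rightarrow> nat ugraph" where
  "path_graph n = \<lparr>verts = {1..n}, edges = {{i, i + 1} | i. 1 \<le> i \<and> i < n}\<rparr>"

definition packing_class :: "nat \<Rightarrow> (nat \<Rightarrow> nat) set" where
  "packing_class k = {S. packing_sequence S \<and>
     (\<forall>i. 1 \<le> i \<and> i \<le> k - 1 \<longrightarrow> 2 ^ (i - 1) \<le> S i \<and> S i < 2 ^ i) \<and>
     S k < 2 ^ (k - 1)}"

lemma simple_graph_path_graph: "simple_graph (path_graph n)"
  by (auto simp: simple_graph_def path_graph_def)

(* On finite graphs the minimum defining chi ranges over a nonempty set. *)
lemma packing_coloring_exists:
  assumes "finite (verts G)"
  shows "\<exists>k \<phi>. packing_coloring S G k \<phi>"
proof -
  obtain \<phi> where "bij_betw \<phi> (verts G) {1..card (verts G)}"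
    using ex_bij_betw_finite_nat[OF assms] assms
    by (metis bij_betw_iff_card card_atLeastAtMost diff_Suc_1 finite_atLeastAtMost)
  then have "packing_coloring S G (card (verts G)) \<phi>"
    unfolding packing_coloring_def bij_betw_def inj_on_def by auto
  then show ?thesis by blast
qed

end

(* A coloring of an interval with colors 1..j satisfying s_i >= 2^(i-1) uses color j at most
   once: by induction, a stretch avoiding j has fewer than 2^(j-1) vertices, so two consecutive
   occurrences of j would be at distance at most 2^(j-1).  Hence the interval has fewer than 2^j
   vertices.  Conversely, when s_i < 2^i, coloring v by one plus its 2-adic valuation works for
   n < 2^j.  Thus j + 1 colors become necessary exactly at n = 2^j, and deleting an edge from
   P_(2^j) leaves two paths with fewer than 2^j vertices each. *)

theory Submission imports Defs "HOL-Computational_Algebra.Primes" begin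

lemma path_graph_simps [simp]:
  "verts (path_graph n) = {1..n}"
  "edges (path_graph n) = {{i, i + 1} | i. 1 \<le> i \<and> i < n}"
  by (simp_all add: path_graph_def)

lemma path_graph_edgeD:
  assumes "{x, y} \<in> edges (path_graph n)"
  shows "y = Suc x \<or> x = Suc y"
  using assms by (auto simp: doubleton_eq_iff)

section \<open>Distances in subgraphs of a path\<close>

text \<open>Each step along a path in \<open>H\<close> changes the vertex number by exactly one, so
  i steps move it by at most i. Natural subtraction truncates, so the two inequalities together
  bound the absolute difference of \<open>u\<close> and \<open>v\<close>.\<close>

lemma path_between_length:
  assumes "subgraph H (path_graph n)" "path_between H u p v"
  shows "v - u \<le> length p - 1" "u - v \<le> length p - 1"
proof -
  have step: "p ! Suc i = Suc (p ! i) \<or> p ! i = Suc (p ! Suc i)" if "Suc i < length p" for i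
    using assms that path_graph_edgeD[of "p ! i" "p ! Suc i" n]
    unfolding subgraph_def path_between_def by blast
  have "p ! i \<le> p ! 0 + i \<and> p ! 0 \<le> p ! i + i" if "i < length p" for i
    using that
  proof (induction i)
    case (Suc i)
    then show ?case using step[of i] by auto
  qed simp
  from this[of "length p - 1"] show "v - u \<le> length p - 1" "u - v \<le> length p - 1"
    using assms(2) unfolding path_between_def by (auto simp: hd_conv_nth last_conv_nth)
qed

text \<open>Steps have size one, so the only way from numbers up to \<open>a\<close> to numbers
  above \<open>a\<close>, or back, is the edge \<open>{a, Suc a}\<close>.\<close>

lemma path_between_missing_edge:
  assumes H: "subgraph H (path_graph n)" and p: "path_between H u p v"
    and a: "{a, Suc a} \<notin> edges H"
  shows "u \<le> a \<longleftrightarrow> v \<le> a"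
proof -
  have step: "p ! i \<le> a \<longleftrightarrow> p ! Suc i \<le> a" if "Suc i < length p" for i
  proof -
    have e: "{p ! i, p ! Suc i} \<in> edges H"
      using p that unfolding path_between_def by blast
    then have "{p ! i, p ! Suc i} \<in> edges (path_graph n)"
      using H unfolding subgraph_def by blast
    then have "p ! Suc i = Suc (p ! i) \<or> p ! i = Suc (p ! Suc i)"
      by (rule path_graph_edgeD)
    then show ?thesis
    proof
      assume succ: "p ! Suc i = Suc (p ! i)"
      then have "p ! i \<noteq> a" using e a by auto
      then show ?thesis using succ by linarith
    next
      assume pred: "p ! i = Suc (p ! Suc i)"
      then have "p ! Suc i \<noteq> a" using e a by (auto simp: insert_commute)
      then show ?thesis using pred by linarith
    qed
  qed
  have "p ! 0 \<le> a \<longleftrightarrow> p ! i \<le> a" if "i < length p" for i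
    using that
  proof (induction i)
    case (Suc i)
    then show ?case using step[of i] by auto
  qed simp
  from this[of "length p - 1"] show ?thesis
    using p unfolding path_between_def by (auto simp: hd_conv_nth last_conv_nth)
qed

lemma graph_dist_ge:
  assumes "subgraph H (path_graph n)"
  shows "enat (v - u) \<le> graph_dist H u v" "enat (u - v) \<le> graph_dist H u v"
  unfolding graph_dist_def using path_between_length[OF assms] by (auto intro!: INF_greatest)

lemma graph_dist_missing_edge:
  assumes "subgraph H (path_graph n)" "{a, Suc a} \<notin> edges H" "(u \<le> a) \<noteq> (v \<le> a)"
  shows "graph_dist H u v = \<infinity>"
proof -
  have "{p. path_between H u p v} = {}"
    using path_between_missing_edge[OF assms(1) _ assms(2)] assms(3) by blast
  then show ?thesis by (simp add: graph_dist_def top_enat_def)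
qed

lemma graph_dist_path_graph_le:
  assumes "1 \<le> u" "u \<le> v" "v \<le> n"
  shows "graph_dist (path_graph n) u v \<le> enat (v - u)"
proof -
  have "path_between (path_graph n) u [u..<Suc v] v"
    using assms unfolding path_between_def by (auto simp del: upt_Suc simp: last_conv_nth)
  then have "graph_dist (path_graph n) u v \<le> enat (length [u..<Suc v] - 1)"
    unfolding graph_dist_def by (intro INF_lower) simp
  then show ?thesis by (simp del: upt_Suc)
qed

text \<open>Turns graph distance into arithmetic for all colorings built below: distance in
  \<open>H\<close> is at least the difference of the numbers, and infinite across a missing edge.
  Both orders of a pair are covered by checking \<open>u < v\<close> only.\<close>

lemma packing_coloring_subgraph_pathI:
  assumes H: "subgraph H (path_graph n)" and "\<phi> \<in> verts H \<rightarrow> {1..k}"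
    and sep: "\<And>u v. u \<in> verts H \<Longrightarrow> v \<in> verts H \<Longrightarrow> u < v \<Longrightarrow> \<phi> u = \<phi> v \<Longrightarrow>
      S (\<phi> u) < v - u \<or> (\<exists>a. u \<le> a \<and> a < v \<and> {a, Suc a} \<notin> edges H)"
  shows "packing_coloring S H k \<phi>"
proof -
  have "enat (S (\<phi> u)) < graph_dist H u v \<and> enat (S (\<phi> u)) < graph_dist H v u"
    if uv: "u \<in> verts H" "v \<in> verts H" "u < v" "\<phi> u = \<phi> v" for u v
    using sep[OF uv]
  proof
    assume "S (\<phi> u) < v - u"
    then have "enat (S (\<phi> u)) < enat (v - u)" by simp
    then show ?thesis
      using graph_dist_ge(1)[OF H, of v u] graph_dist_ge(2)[OF H, of v u]
      by (meson less_le_trans)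
  next
    assume "\<exists>a. u \<le> a \<and> a < v \<and> {a, Suc a} \<notin> edges H"
    then obtain a where "u \<le> a" "a < v" "{a, Suc a} \<notin> edges H" by blast
    then show ?thesis
      using graph_dist_missing_edge[OF H, of a u v] graph_dist_missing_edge[OF H, of a v u]
      by simp
  qed
  then show ?thesis
    using assms(2) unfolding packing_coloring_def by (metis linorder_neqE_nat)
qed

section \<open>Lower bound\<close>

text \<open>The start \<open>a\<close> and the length \<open>n\<close> vary in the induction,
  because the hypothesis is applied to stretches between occurrences of the largest color.
  Separation is measured by \<open>v - u\<close>, so it passes to every such stretch.\<close>

lemma interval_coloring_length:
  fixes f :: "nat \<Rightarrow> nat"
  assumes "\<And>i. 1 \<le> i \<Longrightarrow> i \<le> j \<Longrightarrow> 2 ^ (i - 1) \<le> S i"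
    and "\<And>v. a \<le> v \<Longrightarrow> v < a + n \<Longrightarrow> 1 \<le> f v \<and> f v \<le> j"
    and "\<And>u v. a \<le> u \<Longrightarrow> u < v \<Longrightarrow> v < a + n \<Longrightarrow> f u = f v \<Longrightarrow> S (f u) < v - u"
  shows "n < 2 ^ j"
  using assms
proof (induction j arbitrary: a n)
  case 0
  show ?case using "0.prems"(2)[of a] by (cases n) auto
next
  case (Suc j)
  \<comment> \<open>The induction hypothesis for a subinterval that avoids color
    \<open>Suc j\<close>.\<close>
  have gap: "m < 2 ^ j"
    if "a \<le> b" "b + m \<le> a + n" "\<And>v. b \<le> v \<Longrightarrow> v < b + m \<Longrightarrow> f v \<noteq> Suc j" for b m
  proof (rule Suc.IH)
    show "2 ^ (i - 1) \<le> S i" if "1 \<le> i" "i \<le> j" for i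
      using Suc.prems(1) that by simp
    show "1 \<le> f v \<and> f v \<le> j" if "b \<le> v" "v < b + m" for v
      using Suc.prems(2)[of v] that \<open>a \<le> b\<close> \<open>b + m \<le> a + n\<close>
        \<open>\<And>v. b \<le> v \<Longrightarrow> v < b + m \<Longrightarrow> f v \<noteq> Suc j\<close>[of v] by auto
    show "S (f u) < v - u" if "b \<le> u" "u < v" "v < b + m" "f u = f v" for u v
      using Suc.prems(3)[of u v] that \<open>a \<le> b\<close> \<open>b + m \<le> a + n\<close> by auto
  qed
  show ?case
  proof (cases "\<exists>v. a \<le> v \<and> v < a + n \<and> f v = Suc j")
    case False
    then have "n < 2 ^ j" using gap[of a n] by auto
    then show ?thesis by simp
  next
    case True
    define x where "x = (LEAST v. a \<le> v \<and> v < a + n \<and> f v = Suc j)"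
    have x: "a \<le> x" "x < a + n" "f x = Suc j"
      using LeastI_ex[OF True] unfolding x_def by auto
    have before: "f v \<noteq> Suc j" if "a \<le> v" "v < x" for v
      using not_less_Least[of v "\<lambda>v. a \<le> v \<and> v < a + n \<and> f v = Suc j"] that x(2)
      unfolding x_def[symmetric] by auto
    have after: "f v \<noteq> Suc j" if "x < v" "v < a + n" for v
    proof
      assume fv: "f v = Suc j"
      let ?P = "\<lambda>w. x < w \<and> w < a + n \<and> f w = Suc j"
      define y where "y = (LEAST w. ?P w)"
      \<comment> \<open>For the next occurrence \<open>y\<close> of the color, fewer than
        \<open>2 ^ j\<close> vertices lie strictly between, so \<open>y - x\<close> is at most
        \<open>2 ^ j\<close>; but \<open>S (Suc j)\<close> is at least \<open>2 ^ j\<close> and must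
        be smaller than \<open>y - x\<close>.\<close>
      have y: "?P y" unfolding y_def by (rule LeastI[of ?P v]) (use that fv in auto)
      have "f w \<noteq> Suc j" if "Suc x \<le> w" "w < y" for w
        using not_less_Least[of w ?P] that y unfolding y_def[symmetric] by auto
      then have "y - Suc x < 2 ^ j" using gap[of "Suc x" "y - Suc x"] x y by auto
      moreover have "2 ^ j < y - x"
        using Suc.prems(1)[of "Suc j"] Suc.prems(3)[of x y] x y by auto
      ultimately show False by simp
    qed
    \<comment> \<open>At most \<open>2 ^ j - 1\<close> vertices lie on either side of
      \<open>x\<close>; with \<open>x\<close> itself this makes at most
      \<open>2 ^ Suc j - 1\<close>.\<close>
    have "x - a < 2 ^ j" using gap[of a "x - a"] before x by auto
    moreover have "a + n - Suc x < 2 ^ j"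
      using gap[of "Suc x" "a + n - Suc x"] after x by auto
    ultimately show ?thesis using x by simp
  qed
qed

lemma packing_coloring_path_graph_length:
  assumes "\<And>i. 1 \<le> i \<Longrightarrow> i \<le> j \<Longrightarrow> 2 ^ (i - 1) \<le> S i"
    and col: "packing_coloring S (path_graph n) j \<phi>"
  shows "n < 2 ^ j"
proof (rule interval_coloring_length[where a = 1 and f = \<phi> and S = S])
  show "1 \<le> \<phi> v \<and> \<phi> v \<le> j" if "1 \<le> v" "v < 1 + n" for v
    using col that unfolding packing_coloring_def by (auto simp: Pi_iff)
  show "S (\<phi> u) < v - u" if "1 \<le> u" "u < v" "v < 1 + n" "\<phi> u = \<phi> v" for u v
  proof -
    have "u \<in> verts (path_graph n)" "v \<in> verts (path_graph n)" "u \<noteq> v" using that by auto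
    then have "enat (S (\<phi> u)) < graph_dist (path_graph n) u v"
      using col that(4) unfolding packing_coloring_def by metis
    also have "\<dots> \<le> enat (v - u)"
      using that by (intro graph_dist_path_graph_le) auto
    finally show ?thesis by simp
  qed
qed (use assms in auto)

lemma chi_le: "packing_coloring S G k \<phi> \<Longrightarrow> chi S G \<le> k"
  unfolding chi_def by (rule Least_le) blast

lemma chi_path_graph_gt:
  assumes "\<And>i. 1 \<le> i \<Longrightarrow> i \<le> j \<Longrightarrow> 2 ^ (i - 1) \<le> S i" and "2 ^ j \<le> n"
  shows "j < chi S (path_graph n)"
proof (rule ccontr)
  assume "\<not> j < chi S (path_graph n)"
  then have le: "chi S (path_graph n) \<le> j" by simp
  have "\<exists>k \<phi>. packing_coloring S (path_graph n) k \<phi>"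
    by (rule packing_coloring_exists) simp
  \<comment> \<open>Since some coloring exists, the minimum is attained; the length bound is then
    applied with \<open>chi\<close> colors instead of \<open>j\<close>.\<close>
  from LeastI_ex[OF this] obtain \<phi>
    where "packing_coloring S (path_graph n) (chi S (path_graph n)) \<phi>"
    unfolding chi_def by blast
  then have "n < 2 ^ chi S (path_graph n)"
    using assms(1) le by (intro packing_coloring_path_graph_length) auto
  also have "\<dots> \<le> 2 ^ j" using le by (simp add: power_increasing)
  finally show False using assms(2) by simp
qed

section \<open>Colorings by 2-adic valuation\<close>

lemma valuation_gap:
  fixes u v :: nat
  assumes "0 < u" "u < v" "multiplicity 2 u = multiplicity 2 v"
  shows "2 ^ Suc (multiplicity 2 u) \<le> v - u"
proof -
  let ?m = "multiplicity 2 u"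
  obtain x where x: "u = 2 ^ ?m * x" "odd x"
    using multiplicity_decompose'[of u 2] assms(1) by auto
  obtain y where y: "v = 2 ^ ?m * y" "odd y"
    using multiplicity_decompose'[of v 2] assms by auto
  have "x < y" using x(1) y(1) assms(2) by (metis mult_le_mono2 not_less)
  \<comment> \<open>Distinct odd cofactors differ by at least 2, which gives the extra factor 2 in
    the gap.\<close>
  with x(2) y(2) have "x + 2 \<le> y" by presburger
  then have "2 ^ ?m * (x + 2) \<le> 2 ^ ?m * y" by (rule mult_le_mono2)
  then show ?thesis using x(1) y(1) by (simp add: algebra_simps)
qed

lemma valuation_bound:
  fixes v :: nat
  assumes "0 < v" "v < 2 ^ j"
  shows "multiplicity 2 v < j"
proof -
  have "2 ^ multiplicity 2 v \<le> v"
    using assms(1) by (intro dvd_imp_le multiplicity_dvd) auto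
  also note assms(2)
  finally have "(2::nat) ^ multiplicity 2 v < 2 ^ j" .
  then show ?thesis by simp
qed

lemma subgraph_path_graph: "m \<le> n \<Longrightarrow> subgraph (path_graph m) (path_graph n)"
  using simple_graph_path_graph[of m] unfolding subgraph_def by auto

text \<open>Color i goes to the odd multiples of \<open>2 ^ (i - 1)\<close>, which are at least
  \<open>2 ^ i\<close> apart. The \<open>Suc\<close> in the coloring makes colors start at
  1.\<close>

lemma chi_path_graph_le:
  assumes "\<And>i. 1 \<le> i \<Longrightarrow> i \<le> j \<Longrightarrow> S i < 2 ^ i" and "n < 2 ^ j"
  shows "chi S (path_graph n) \<le> j"
proof (rule chi_le, rule packing_coloring_subgraph_pathI[OF subgraph_path_graph[OF order_refl]])
  let ?\<phi> = "\<lambda>v. Suc (multiplicity 2 v)"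
  show range: "?\<phi> \<in> verts (path_graph n) \<rightarrow> {1..j}"
    using assms(2) by (auto intro!: Suc_leI valuation_bound)
  fix u v
  assume uv: "u \<in> verts (path_graph n)" "v \<in> verts (path_graph n)" "u < v" "?\<phi> u = ?\<phi> v"
  have "S (?\<phi> u) < 2 ^ ?\<phi> u"
    using assms(1)[of "?\<phi> u"] funcset_mem[OF range uv(1)] by simp
  also have "\<dots> \<le> v - u" using valuation_gap[of u v] uv by simp
  finally show "S (?\<phi> u) < v - u \<or> (\<exists>a. u \<le> a \<and> a < v \<and> {a, Suc a} \<notin> edges (path_graph n))" ..
qed

text \<open>Capping the valuation at \<open>j\<close> gives the last color to all multiples of
  \<open>2 ^ j\<close>. They are at least \<open>2 ^ j\<close> apart, which exceeds
  \<open>S (Suc j)\<close>, so \<open>Suc j\<close> colors suffice for paths of any length.\<close>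

lemma chi_path_graph_le_Suc:
  assumes "\<And>i. 1 \<le> i \<Longrightarrow> i \<le> j \<Longrightarrow> S i < 2 ^ i" and "S (Suc j) < 2 ^ j"
  shows "chi S (path_graph n) \<le> Suc j"
proof (rule chi_le, rule packing_coloring_subgraph_pathI[OF subgraph_path_graph[OF order_refl]])
  let ?\<phi> = "\<lambda>v. Suc (min (multiplicity 2 v) j)"
  show "?\<phi> \<in> verts (path_graph n) \<rightarrow> {1..Suc j}" by auto
  fix u v
  assume uv: "u \<in> verts (path_graph n)" "v \<in> verts (path_graph n)" "u < v" "?\<phi> u = ?\<phi> v"
  have "S (?\<phi> u) < v - u"
  proof (cases "multiplicity 2 u < j")
    case True
    then have "multiplicity 2 u = multiplicity 2 v" using uv(4) by auto
    then have "2 ^ Suc (multiplicity 2 u) \<le> v - u" using valuation_gap[of u v] uv by auto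
    moreover have "S (?\<phi> u) < 2 ^ Suc (multiplicity 2 u)"
      using assms(1)[of "Suc (multiplicity 2 u)"] True by auto
    ultimately show ?thesis by linarith
  next
    case False
    then have "j \<le> multiplicity 2 u" "j \<le> multiplicity 2 v" using uv(4) by auto
    then have "2 ^ j dvd u" "2 ^ j dvd v" by (auto intro: multiplicity_dvd')
    then have "2 ^ j \<le> v - u" using uv(3) by (intro dvd_imp_le) auto
    then show ?thesis using False assms(2) by (simp add: min_def)
  qed
  then show "S (?\<phi> u) < v - u \<or> (\<exists>a. u \<le> a \<and> a < v \<and> {a, Suc a} \<notin> edges (path_graph n))" ..
qed

section \<open>Critical paths\<close>

lemma chi_proper_subgraph_le:
  assumes S: "\<And>i. 1 \<le> i \<Longrightarrow> i \<le> j \<Longrightarrow> S i < 2 ^ i"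
    and H: "proper_subgraph H (path_graph (2 ^ j))"
  shows "chi S H \<le> j"
proof -
  let ?n = "2 ^ j :: nat"
  have sub: "subgraph H (path_graph ?n)" and "H \<noteq> path_graph ?n"
    using H unfolding proper_subgraph_def by auto
  have vH: "verts H \<subseteq> {1..?n}" and eH: "edges H \<subseteq> edges (path_graph ?n)"
    and simple: "simple_graph H"
    using sub unfolding subgraph_def by auto
  show ?thesis
  proof (cases "j = 0")
    \<comment> \<open>The path is a single vertex here, so its only proper subgraph is empty and
      needs 0 colors.\<close>
    case True
    have "edges H = {}" using eH True by auto
    then have "verts H \<noteq> {1}" using \<open>H \<noteq> path_graph ?n\<close> True by (auto simp: path_graph_def)
    then have "verts H = {}" using vH True by auto
    then have "packing_coloring S H 0 id" by (auto simp: packing_coloring_def)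
    then show ?thesis using True chi_le by fastforce
  next
    case False
    then have n2: "2 \<le> ?n" using self_le_power[of 2 j] by simp
    \<comment> \<open>With at least two vertices, every vertex of the path lies on an edge. A
      subgraph with all edges thus has all vertices and is not proper.\<close>
    have "\<exists>a. 1 \<le> a \<and> a < ?n \<and> {a, Suc a} \<notin> edges H"
    proof (rule ccontr)
      assume "\<nexists>a. 1 \<le> a \<and> a < ?n \<and> {a, Suc a} \<notin> edges H"
      then have all: "{a, Suc a} \<in> edges H" if "1 \<le> a" "a < ?n" for a using that by blast
      then have "edges H = edges (path_graph ?n)" using eH by auto
      moreover have "v \<in> verts H" if "1 \<le> v" "v \<le> ?n" for v
      proof (cases "v < ?n")
        case True
        then show ?thesis using all[of v] simple that unfolding simple_graph_def by blast
      next
        case False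
        then have "{v - 1, v} \<in> edges H" using all[of "v - 1"] that n2 by simp
        then show ?thesis using simple unfolding simple_graph_def by blast
      qed
      then have "verts H = verts (path_graph ?n)" using vH by auto
      ultimately have "H = path_graph ?n" by (metis (full_types) old.unit.exhaust ugraph.surjective)
      then show False using \<open>H \<noteq> path_graph ?n\<close> by simp
    qed
    then obtain a where a: "1 \<le> a" "a < ?n" "{a, Suc a} \<notin> edges H" by blast
    \<comment> \<open>Numbering restarts at 1 after the missing edge. As \<open>1 \<le> a\<close>
      and \<open>a < 2 ^ j\<close>, positions on both sides stay below \<open>2 ^ j\<close>, so
      valuations stay below \<open>j\<close>.\<close>
    define pos where "pos v = (if v \<le> a then v else v - a)" for v
    have pos: "0 < pos v" "pos v < ?n" if "v \<in> verts H" for v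
      using that vH a by (auto simp: pos_def)
    let ?\<phi> = "\<lambda>v. Suc (multiplicity 2 (pos v))"
    have range: "?\<phi> \<in> verts H \<rightarrow> {1..j}"
      using pos by (auto intro!: Suc_leI valuation_bound)
    have "packing_coloring S H j ?\<phi>"
    proof (rule packing_coloring_subgraph_pathI[OF sub range])
      fix u v
      assume uv: "u \<in> verts H" "v \<in> verts H" "u < v" "?\<phi> u = ?\<phi> v"
      show "S (?\<phi> u) < v - u \<or> (\<exists>a. u \<le> a \<and> a < v \<and> {a, Suc a} \<notin> edges H)"
      proof (cases "u \<le> a \<and> a < v")
        case True
        then show ?thesis using a by blast
      next
        case False
        \<comment> \<open>Both vertices lie on the same side of the missing edge, where
          \<open>pos\<close> is a shift and preserves differences.\<close>
        then have "pos v - pos u = v - u" "pos u < pos v" using uv(3) by (auto simp: pos_def)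
        then have "2 ^ ?\<phi> u \<le> v - u" using valuation_gap[of "pos u" "pos v"] pos uv by auto
        moreover have "S (?\<phi> u) < 2 ^ ?\<phi> u"
          using S[of "?\<phi> u"] funcset_mem[OF range uv(1)] by simp
        ultimately show ?thesis by linarith
      qed
    qed
    then show ?thesis by (rule chi_le)
  qed
qed

lemma chi_critical_path_graph_power:
  assumes "\<And>i. 1 \<le> i \<Longrightarrow> i \<le> j \<Longrightarrow> 2 ^ (i - 1) \<le> S i \<and> S i < 2 ^ i"
  shows "chi_critical S (path_graph (2 ^ j))"
  using chi_proper_subgraph_le[of j S] chi_path_graph_gt[of j S "2 ^ j"] assms
  unfolding chi_critical_def by fastforce

text \<open>Deleting an end vertex leaves at least \<open>2 ^ j\<close> vertices, which still
  require \<open>Suc j\<close> colors.\<close>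

lemma not_chi_critical_path_graph:
  assumes "\<And>i. 1 \<le> i \<Longrightarrow> i \<le> j \<Longrightarrow> 2 ^ (i - 1) \<le> S i"
    and "2 ^ j < n" and "chi S (path_graph n) \<le> Suc j"
  shows "\<not> chi_critical S (path_graph n)"
proof
  assume crit: "chi_critical S (path_graph n)"
  have "verts (path_graph (n - 1)) \<noteq> verts (path_graph n)"
    using assms(2) by simp
  then have "path_graph (n - 1) \<noteq> path_graph n" by metis
  then have "proper_subgraph (path_graph (n - 1)) (path_graph n)"
    unfolding proper_subgraph_def using subgraph_path_graph[of "n - 1" n] by simp
  then have "chi S (path_graph (n - 1)) < chi S (path_graph n)"
    using crit unfolding chi_critical_def by blast
  moreover have "j < chi S (path_graph (n - 1))"
    using assms(1,2) by (intro chi_path_graph_gt) auto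
  ultimately show False using assms(3) by simp
qed

text \<open>\<open>chi\<close> equals \<open>Suc j\<close> for all lengths from \<open>2 ^ j\<close>
  up to \<open>2 ^ Suc j - 1\<close>, so only the shortest of these paths can be critical.\<close>

lemma chi_critical_imp_power:
  assumes S: "\<And>i. 1 \<le> i \<Longrightarrow> i \<le> Suc j \<Longrightarrow> 2 ^ (i - 1) \<le> S i \<and> S i < 2 ^ i"
    and n: "2 ^ j \<le> n" "n < 2 ^ Suc j" and crit: "chi_critical S (path_graph n)"
  shows "n = 2 ^ j"
proof (rule ccontr)
  assume "n \<noteq> 2 ^ j"
  then have "2 ^ j < n" using n by simp
  moreover have "chi S (path_graph n) \<le> Suc j"
    using S n by (intro chi_path_graph_le) auto
  ultimately show False
    using not_chi_critical_path_graph[of j S n] S crit by auto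
qed

theorem theorem3p4:
  fixes S :: "nat \<Rightarrow> nat" and k :: nat
  assumes "packing_sequence S" and "S 1 = 1" and "k \<ge> 2"
  shows "(S \<in> packing_class k \<longrightarrow>
            (\<forall>n\<ge>1. chi_critical S (path_graph n) \<longleftrightarrow> n \<in> {2 ^ j | j. j \<le> k - 1}))
       \<and> ((\<forall>i\<ge>1. 2 ^ (i - 1) \<le> S i \<and> S i < 2 ^ i) \<longrightarrow>
            (\<forall>n\<ge>1. chi_critical S (path_graph n) \<longleftrightarrow> n \<in> {2 ^ j | j. True}))"
proof (intro conjI impI allI)
  fix n :: nat
  assume cls: "S \<in> packing_class k" and n: "1 \<le> n"
  \<comment> \<open>Colors up to \<open>m\<close> satisfy both dyadic bounds; color
    \<open>Suc m\<close> is the one whose value drops below \<open>2 ^ m\<close>.\<close>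
  obtain m where k: "k = Suc m" using assms(3) by (cases k) auto
  have S: "2 ^ (i - 1) \<le> S i \<and> S i < 2 ^ i" if "1 \<le> i" "i \<le> m" for i
    using cls that unfolding packing_class_def k by auto
  have Sk: "S (Suc m) < 2 ^ m"
    using cls unfolding packing_class_def k by auto
  \<comment> \<open>The dyadic block that contains \<open>n\<close>.\<close>
  obtain j where j: "2 ^ j \<le> n" "n < 2 ^ Suc j"
    using ex_power_ivl1[of 2 n] n by auto
  show "chi_critical S (path_graph n) \<longleftrightarrow> n \<in> {2 ^ j | j. j \<le> k - 1}"
  proof
    assume crit: "chi_critical S (path_graph n)"
    show "n \<in> {2 ^ j | j. j \<le> k - 1}"
    proof (cases "j < m")
      case True
      \<comment> \<open>Here \<open>Suc j \<le> m\<close>, so both bounds hold for all the colors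
        involved.\<close>
      then have "n = 2 ^ j" using S j crit by (intro chi_critical_imp_power) auto
      then show ?thesis using True k by auto
    next
      case False
      \<comment> \<open>From length \<open>2 ^ m\<close> on, \<open>chi\<close> stays at
        \<open>Suc m\<close>, since the capped coloring works for every length; hence no path longer
        than \<open>2 ^ m\<close> is critical.\<close>
      then have "(2::nat) ^ m \<le> 2 ^ j" by (intro power_increasing) auto
      then have "2 ^ m \<le> n" using j(1) by linarith
      moreover have "\<not> 2 ^ m < n"
        using not_chi_critical_path_graph[of m S n] chi_path_graph_le_Suc[of m S n] S Sk crit
        by auto
      ultimately have "n = 2 ^ m" by simp
      then show ?thesis using k by auto
    qed
  next
    assume "n \<in> {2 ^ j | j. j \<le> k - 1}"
    then show "chi_critical S (path_graph n)"
      using chi_critical_path_graph_power S k by auto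
  qed
next
  fix n :: nat
  assume S: "\<forall>i\<ge>1. 2 ^ (i - 1) \<le> S i \<and> S i < 2 ^ i" and n: "1 \<le> n"
  obtain j where j: "2 ^ j \<le> n" "n < 2 ^ Suc j"
    using ex_power_ivl1[of 2 n] n by auto
  show "chi_critical S (path_graph n) \<longleftrightarrow> n \<in> {2 ^ j | j. True}"
    \<comment> \<open>With both bounds valid for every color, the argument by dyadic blocks applies
      to every \<open>n\<close>.\<close>
    using chi_critical_imp_power[of j S n] chi_critical_path_graph_power S j by auto
qed

end
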